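(* Let $T\in G$ be a hyperbolic isometry and let $S\in G$ satisfy $ST=TS$. Then $S$ is either a boundary elliptic isometry or a hyperbolic isometry.
   Context: $H$ is a complex Hilbert space with inner product $\langle\cdot,\cdot\rangle$ (linear in the first variable), $B$ its open unit ball. $\mathcal{A}((x,z),(y,w))=\langle x,y\rangle-z\overline{w}$ is a Hermitian form on $H\oplus\mathbb{C}$. $G$ is the group of all bijective bounded linear operators on $H\oplus\mathbb{C}$ preserving $\mathcal{A}$; its elements are called isometries. Each $T\in G$ acts on $\overline{B}$ by $\widetilde{T}(x)=y/w$ where $T(x,1)=(y,w)$. $T$ is elliptic if $\widetilde{T}$ has a fixed point in $B$; $T$ is hyperbolic if it is not elliptic and $\widetilde{T}$ has exactly two fixed points in $\overline{B}$, lying on $\partial B$. An eigenvalue of $T$ is time-like if its eigenspace contains a vector $v$ with $\mathcal{A}(v,v)<0$. An elliptic isometry is boundary elliptic if the geometric multiplicity of its time-like eigenvalue is at least two. *)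

theory Defs
  imports "HOL-Analysis.Analysis" "HOL-Library.Extended_Nat"
begin

class complex_vector = real_vector +
  fixes scaleC :: "complex \<Rightarrow> 'a \<Rightarrow> 'a" (infixr "*\<^sub>C" 75)
  assumes scaleC_add_right: "a *\<^sub>C (x + y) = a *\<^sub>C x + a *\<^sub>C y"
    and scaleC_add_left: "(a + b) *\<^sub>C x = a *\<^sub>C x + b *\<^sub>C x"
    and scaleC_scaleC: "a *\<^sub>C b *\<^sub>C x = (a * b) *\<^sub>C x"
    and scaleC_one: "1 *\<^sub>C x = x"
    and scaleR_scaleC: "r *\<^sub>R x = complex_of_real r *\<^sub>C x"

global_interpretation complex_vector:
  vector_space "scaleC :: complex \<Rightarrow> 'a \<Rightarrow> 'a::complex_vector"
  by unfold_locales (rule scaleC_add_right scaleC_add_left scaleC_scaleC scaleC_one)+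

text \<open>
  Completeness comes from the superclass \<^class>\<open>banach\<close>; the last axiom says that its norm is
  the one induced by the inner product, and so also gives positive definiteness.
\<close>

class complex_hilbert = complex_vector + banach +
  fixes cinner :: "'a \<Rightarrow> 'a \<Rightarrow> complex"
  assumes cinner_commute: "cinner x y = cnj (cinner y x)"
    and cinner_add_left: "cinner (x + y) z = cinner x z + cinner y z"
    and cinner_scaleC_left: "cinner (a *\<^sub>C x) y = a * cinner x y"
    and cinner_self: "cinner x x = complex_of_real ((norm x)\<^sup>2)"

instantiation complex :: complex_hilbert
begin

definition scaleC_complex :: "complex \<Rightarrow> complex \<Rightarrow> complex"
  where "scaleC_complex a x = a * x"

definition cinner_complex :: "complex \<Rightarrow> complex \<Rightarrow> complex"
  where "cinner_complex x y = x * cnj y"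

instance
  by standard
    (auto simp: scaleC_complex_def cinner_complex_def algebra_simps scaleR_conv_of_real
      simp flip: complex_norm_square)

end

instantiation prod :: (complex_vector, complex_vector) complex_vector
begin

definition scaleC_prod :: "complex \<Rightarrow> 'a \<times> 'b \<Rightarrow> 'a \<times> 'b"
  where "scaleC_prod a u = (a *\<^sub>C fst u, a *\<^sub>C snd u)"

instance
  by standard
    (auto simp: scaleC_prod_def prod_eq_iff scaleC_add_right scaleC_add_left scaleC_scaleC
      scaleC_one scaleR_scaleC)

end

definition herm_form :: "'h::complex_hilbert \<times> complex \<Rightarrow> 'h \<times> complex \<Rightarrow> complex"
  where "herm_form u v = cinner (fst u) (fst v) - snd u * cnj (snd v)"

text \<open>
  The predicate \<^const>\<open>bounded_linear\<close> only speaks about real scalars and refers to the norm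
  of the Hilbert direct sum; complex homogeneity is required in addition.
\<close>

definition isometries :: "('h::complex_hilbert \<times> complex \<Rightarrow> 'h \<times> complex) set"
  where "isometries =
    {T. bounded_linear T \<and> (\<forall>c u. T (c *\<^sub>C u) = c *\<^sub>C T u) \<and> bij T \<and>
        (\<forall>u v. herm_form (T u) (T v) = herm_form u v)}"

text \<open>
  For an isometry \<open>T\<close> and \<open>norm x \<le> 1\<close> the second component \<open>w\<close> below is nonzero.
  The value of the map outside the closed unit ball is never used.
\<close>

definition ball_map :: "('h::complex_hilbert \<times> complex \<Rightarrow> 'h \<times> complex) \<Rightarrow> 'h \<Rightarrow> 'h"
  where "ball_map T x = (let (y, w) = T (x, 1) in inverse w *\<^sub>C y)"

definition elliptic :: "('h::complex_hilbert \<times> complex \<Rightarrow> 'h \<times> complex) \<Rightarrow> bool"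
  where "elliptic T \<longleftrightarrow> (\<exists>x \<in> ball 0 1. ball_map T x = x)"

definition hyperbolic :: "('h::complex_hilbert \<times> complex \<Rightarrow> 'h \<times> complex) \<Rightarrow> bool"
  where "hyperbolic T \<longleftrightarrow>
    \<not> elliptic T \<and>
    card {x \<in> cball 0 1. ball_map T x = x} = 2 \<and>
    {x \<in> cball 0 1. ball_map T x = x} \<subseteq> sphere 0 1"

definition eigenspace :: "('a::complex_vector \<Rightarrow> 'a) \<Rightarrow> complex \<Rightarrow> 'a set"
  where "eigenspace T c = {v. T v = c *\<^sub>C v}"

text \<open>
  The complex dimension of the eigenspace, with value \<open>\<infinity>\<close> in the infinite-dimensional case
  (where the library function \<^const>\<open>complex_vector.dim\<close> would return \<open>0\<close>).
\<close>

definition geometric_multiplicity :: "('a::complex_vector \<Rightarrow> 'a) \<Rightarrow> complex \<Rightarrow> enat"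
  where "geometric_multiplicity T c =
    (SUP B \<in> {B. B \<subseteq> eigenspace T c \<and> finite B \<and> complex_vector.independent B}. enat (card B))"

text \<open>
  The number \<open>herm_form v v\<close> is always real, and a vector on which it is negative is nonzero,
  so \<open>c\<close> below is an eigenvalue.
\<close>

definition timelike_eigenvalue ::
    "('h::complex_hilbert \<times> complex \<Rightarrow> 'h \<times> complex) \<Rightarrow> complex \<Rightarrow> bool"
  where "timelike_eigenvalue T c \<longleftrightarrow> (\<exists>v \<in> eigenspace T c. Re (herm_form v v) < 0)"

text \<open>An elliptic isometry has exactly one time-like eigenvalue.\<close>

definition boundary_elliptic :: "('h::complex_hilbert \<times> complex \<Rightarrow> 'h \<times> complex) \<Rightarrow> bool"
  where "boundary_elliptic T \<longleftrightarrow>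
    elliptic T \<and> (\<exists>c. timelike_eigenvalue T c \<and> geometric_multiplicity T c \<ge> 2)"

end

theory Submission imports Defs begin

text \<open>
  The two fixed points of \<open>T\<close> on the sphere are light-like eigenvectors \<open>u\<close>, \<open>v\<close> of \<open>T\<close>, with
  \<open>\<A>(u,v) \<noteq> 0\<close>. Their eigenvalues differ, since otherwise a combination of \<open>u\<close> and \<open>v\<close> would be
  a time-like eigenvector; as \<open>S\<close> commutes with \<open>T\<close>, it cannot exchange the two lines, so
  \<open>S u = p u\<close> and \<open>S v = q v\<close> with \<open>p * cnj q = 1\<close>. If \<open>p = q\<close>, the plane spanned by \<open>u\<close> and \<open>v\<close>
  lies in a single eigenspace and contains a time-like vector. If \<open>p \<noteq> q\<close>, then any further
  fixed point would give an eigenvector orthogonal neither to \<open>u\<close> nor to \<open>v\<close>, and its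
  eigenvalue \<open>r\<close> would satisfy \<open>r * cnj p = 1 = r * cnj q\<close>.
\<close>

lemma cinner_add_right:
  "cinner x (y + z) = cinner x y + cinner x (z :: 'h::complex_hilbert)"
  by (metis cinner_add_left cinner_commute complex_cnj_add)

lemma cinner_scaleC_right:
  "cinner x (a *\<^sub>C y) = cnj a * cinner x (y :: 'h::complex_hilbert)"
  by (metis cinner_commute cinner_scaleC_left complex_cnj_mult)

lemma cinner_diff_left:
  "cinner (x - y) z = cinner x z - cinner y (z :: 'h::complex_hilbert)"
  by (metis add_diff_cancel_right' cinner_add_left diff_add_cancel)

lemma cinner_diff_right:
  "cinner x (y - z) = cinner x y - cinner x (z :: 'h::complex_hilbert)"
  by (metis add_diff_cancel_right' cinner_add_right diff_add_cancel)

lemma herm_form_add_left: "herm_form (u + v) w = herm_form u w + herm_form v w"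
  and herm_form_add_right: "herm_form w (u + v) = herm_form w u + herm_form w v"
  and herm_form_scaleC_left: "herm_form (c *\<^sub>C u) w = c * herm_form u w"
  and herm_form_scaleC_right: "herm_form w (c *\<^sub>C u) = cnj c * herm_form w u"
  by (simp_all add: herm_form_def scaleC_prod_def scaleC_complex_def cinner_add_left
      cinner_add_right cinner_scaleC_left cinner_scaleC_right algebra_simps)

lemma herm_form_commute: "herm_form u v = cnj (herm_form v u)"
  by (metis (no_types, lifting) cinner_commute complex_cnj_cnj complex_cnj_diff complex_cnj_mult
      herm_form_def mult.commute)

lemma herm_form_self: "herm_form u u = of_real ((norm (fst u))\<^sup>2 - (norm (snd u))\<^sup>2)"
  by (simp add: herm_form_def cinner_self flip: complex_norm_square)

text \<open>The norm is tied to complex scalars only through \<open>cinner_self\<close>, so the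
  squares of both sides are compared.\<close>

lemma norm_scaleC: "norm (c *\<^sub>C x) = norm c * norm (x :: 'h::complex_hilbert)"
proof -
  have "complex_of_real ((norm (c *\<^sub>C x))\<^sup>2) = of_real ((norm c * norm x)\<^sup>2)"
    unfolding power_mult_distrib of_real_mult complex_norm_square[of c]
    by (simp only: cinner_scaleC_left cinner_scaleC_right ac_simps flip: cinner_self)
  then have "(norm (c *\<^sub>C x))\<^sup>2 = (norm c * norm x)\<^sup>2"
    using of_real_eq_iff by blast
  then show ?thesis by simp
qed

text \<open>An equality case of Cauchy-Schwarz: expanding the square of \<open>norm (x - y)\<close>
  gives at most 1 - 2 + 1 = 0.\<close>

lemma cinner_eq_1_imp_eq:
  fixes x y :: "'h::complex_hilbert"
  assumes "norm x \<le> 1" "norm y \<le> 1" "cinner x y = 1"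
  shows "x = y"
proof -
  have "cinner (x - y) (x - y)
      = cinner x x - cinner x y - cinner y x + cinner y y"
    by (simp add: cinner_diff_left cinner_diff_right)
  moreover have "cinner y x = 1"
    using assms(3) by (metis cinner_commute complex_cnj_one)
  ultimately have "complex_of_real ((norm (x - y))\<^sup>2) = of_real ((norm x)\<^sup>2 - 2 + (norm y)\<^sup>2)"
    using assms(3) by (simp add: cinner_self)
  then have "(norm (x - y))\<^sup>2 = (norm x)\<^sup>2 - 2 + (norm y)\<^sup>2"
    using of_real_eq_iff by blast
  moreover have "(norm x)\<^sup>2 \<le> 1" "(norm y)\<^sup>2 \<le> 1"
    using assms by (simp_all add: power_le_one)
  ultimately have "(norm (x - y))\<^sup>2 \<le> 0" by linarith
  then show ?thesis by simp
qed

lemma herm_form_lift_nonzero: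
  assumes "norm x \<le> 1" "norm y \<le> 1" "x \<noteq> y"
  shows "herm_form (x, 1) (y, 1) \<noteq> 0"
  using cinner_eq_1_imp_eq[OF assms(1,2)] assms(3) by (auto simp: herm_form_def)

lemma isometries_scaleC: "S \<in> isometries \<Longrightarrow> S (c *\<^sub>C u) = c *\<^sub>C S u"
  and isometries_add: "S \<in> isometries \<Longrightarrow> S (u + v) = S u + S v"
  and isometries_herm_form: "S \<in> isometries \<Longrightarrow> herm_form (S u) (S v) = herm_form u v"
  by (simp_all add: isometries_def bounded_linear.linear linear_add del: split_paired_All)

lemma isometries_eq_0_iff: "S \<in> isometries \<Longrightarrow> S u = 0 \<longleftrightarrow> u = 0"
  by (metis (mono_tags, lifting) CollectD bij_is_inj bounded_linear.linear inj_eq isometries_def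
      linear_0)

text \<open>On vectors with last component 0 the form is the squared norm, hence positive unless the
  vector is 0.\<close>

lemma snd_nonzero_if_not_spacelike:
  assumes "Re (herm_form u u) \<le> 0" "u \<noteq> 0"
  shows "snd u \<noteq> 0"
  using assms by (cases u) (auto simp: herm_form_self zero_prod_def)

lemma scaleC_snd_lift:
  assumes "snd u \<noteq> 0"
  shows "u = snd u *\<^sub>C (inverse (snd u) *\<^sub>C fst u, 1)"
  using assms by (simp add: prod_eq_iff scaleC_prod_def scaleC_complex_def scaleC_scaleC scaleC_one)

lemma norm_lift:
  fixes u :: "'h::complex_hilbert \<times> complex"
  shows "norm (inverse (snd u) *\<^sub>C fst u) = norm (fst u) / norm (snd u)"
  by (simp add: norm_scaleC norm_inverse divide_inverse)

text \<open>The ball map is the projective action of \<open>S\<close> in the chart where the last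
  coordinate is 1, so its fixed points are the eigenlines through such lifts.\<close>

lemma ball_map_fixed_iff:
  assumes S: "S \<in> isometries" and x: "norm x \<le> 1"
  shows "ball_map S x = x \<longleftrightarrow> (\<exists>r. S (x, 1) = r *\<^sub>C (x, 1))"
proof -
  have bm: "ball_map S x = inverse (snd (S (x, 1))) *\<^sub>C fst (S (x, 1))"
    by (simp add: ball_map_def split_beta)
  have "Re (herm_form (x, 1::complex) (x, 1)) \<le> 0"
    using x by (simp add: herm_form_self power_le_one)
  moreover have "(x, 1::complex) \<noteq> 0" by (simp add: zero_prod_def)
  \<comment> \<open>The image of the lift is again nonzero and not space-like; this excludes the
    default value \<open>inverse 0 = 0\<close> in the ball map.\<close>
  ultimately have nz: "snd (S (x, 1)) \<noteq> 0"
    using S by (intro snd_nonzero_if_not_spacelike)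
      (simp_all add: isometries_herm_form isometries_eq_0_iff)
  show ?thesis
  proof
    assume "ball_map S x = x"
    then show "\<exists>r. S (x, 1) = r *\<^sub>C (x, 1)"
      using scaleC_snd_lift[OF nz] bm by metis
  next
    assume "\<exists>r. S (x, 1) = r *\<^sub>C (x, 1)"
    then obtain r where r: "S (x, 1) = r *\<^sub>C (x, 1)" ..
    then have "r \<noteq> 0" using nz by (auto simp: scaleC_prod_def scaleC_complex_def)
    then show "ball_map S x = x"
      unfolding bm r by (simp add: scaleC_prod_def scaleC_complex_def scaleC_scaleC scaleC_one)
  qed
qed

text \<open>Rescaling the eigenvector to last coordinate 1 turns it into the lift of a point of the
  closed ball, with the same eigenvalue.\<close>

lemma eigenvector_ball_map_fixed:
  assumes S: "S \<in> isometries" and ev: "S u = r *\<^sub>C u"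
    and u: "Re (herm_form u u) \<le> 0" "u \<noteq> 0"
  shows "ball_map S (inverse (snd u) *\<^sub>C fst u) = inverse (snd u) *\<^sub>C fst u"
    and "norm (inverse (snd u) *\<^sub>C fst u) \<le> 1"
proof -
  let ?x = "inverse (snd u) *\<^sub>C fst u"
  have nz: "snd u \<noteq> 0" using snd_nonzero_if_not_spacelike[OF u] .
  have "norm (fst u) \<le> norm (snd u)"
    using u(1) power2_le_imp_le[of "norm (fst u)" "norm (snd u)"] by (simp add: herm_form_self)
  then show le: "norm ?x \<le> 1"
    using nz by (simp add: norm_lift)
  have lift: "(?x, 1) = inverse (snd u) *\<^sub>C u"
    using nz by (simp add: scaleC_prod_def scaleC_complex_def)
  have "S (?x, 1) = r *\<^sub>C (?x, 1)"
    unfolding lift isometries_scaleC[OF S] ev by (simp add: scaleC_scaleC mult.commute)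
  then show "ball_map S ?x = ?x"
    using ball_map_fixed_iff[OF S le] by blast
qed

lemma timelike_eigenvector_elliptic:
  assumes S: "S \<in> isometries" and ev: "S u = r *\<^sub>C u" and u: "Re (herm_form u u) < 0"
  shows "elliptic S"
proof -
  have le: "Re (herm_form u u) \<le> 0" using u by simp
  have nz: "u \<noteq> 0" using u by (auto simp: herm_form_self)
  have "norm (fst u) < norm (snd u)"
    using u power2_less_imp_less[of "norm (fst u)" "norm (snd u)"] by (simp add: herm_form_self)
  then have "norm (inverse (snd u) *\<^sub>C fst u) < 1"
    using snd_nonzero_if_not_spacelike[OF le nz] by (simp add: norm_lift)
  then show ?thesis
    unfolding elliptic_def using eigenvector_ball_map_fixed(1)[OF S ev le nz]
    by (intro bexI[of _ "inverse (snd u) *\<^sub>C fst u"]) simp_all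
qed

text \<open>With the coefficient \<open>- herm_form u v\<close> both cross terms become minus the
  squared modulus of \<open>herm_form u v\<close>, while the diagonal terms vanish.\<close>

lemma lightlike_pair_timelike_combination:
  assumes "herm_form u u = 0" "herm_form v v = 0" "herm_form u v \<noteq> 0"
  shows "Re (herm_form (u + (- herm_form u v) *\<^sub>C v) (u + (- herm_form u v) *\<^sub>C v)) < 0"
proof -
  have "herm_form (u + (- herm_form u v) *\<^sub>C v) (u + (- herm_form u v) *\<^sub>C v)
      = - 2 * (herm_form u v * cnj (herm_form u v))"
    using assms(1,2) herm_form_commute[of v u]
    by (simp add: herm_form_add_left herm_form_add_right herm_form_scaleC_left
        herm_form_scaleC_right del: complex_vector.scale_minus_left)
  also have "\<dots> = of_real (- 2 * (norm (herm_form u v))\<^sup>2)"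
    by (simp flip: complex_norm_square)
  finally have eq: "herm_form (u + (- herm_form u v) *\<^sub>C v) (u + (- herm_form u v) *\<^sub>C v)
      = of_real (- 2 * (norm (herm_form u v))\<^sup>2)" .
  show ?thesis unfolding eq Re_complex_of_real using assms(3) by simp
qed

lemma eigenvector_combination:
  assumes "S \<in> isometries" "S u = c *\<^sub>C u" "S v = c *\<^sub>C v"
  shows "S (u + a *\<^sub>C v) = c *\<^sub>C (u + a *\<^sub>C v)"
  using assms
  by (simp add: isometries_add isometries_scaleC scaleC_add_right scaleC_scaleC mult.commute)

text \<open>Invariance of the form multiplies \<open>herm_form u v\<close> by
  \<open>a * cnj b\<close> without changing it; the nonzero factor cancels.\<close>

lemma eigenvalue_product:
  assumes S: "S \<in> isometries" and "S u = a *\<^sub>C u" "S v = b *\<^sub>C v" and nz: "herm_form u v \<noteq> 0"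
  shows "a * cnj b = 1"
  using isometries_herm_form[OF S, of u v] assms
  by (simp add: herm_form_scaleC_left herm_form_scaleC_right mult.commute)

text \<open>Lifts with last coordinate 1 are proportional only when equal, so the two lifts form an
  independent set that bounds the supremum from below.\<close>

lemma geometric_multiplicity_ge_2:
  assumes "x \<noteq> y" "S (x, 1::complex) = c *\<^sub>C (x, 1)" "S (y, 1) = c *\<^sub>C (y, 1)"
  shows "geometric_multiplicity S c \<ge> 2"
proof -
  have "(x, 1) \<notin> complex_vector.span {(y, 1::complex)}"
    using assms(1)
    by (auto simp: complex_vector.span_singleton scaleC_prod_def scaleC_complex_def scaleC_one)
  moreover have "complex_vector.independent {(y, 1::complex)}"
    by (simp add: zero_prod_def)
  ultimately have "complex_vector.independent {(x, 1::complex), (y, 1)}"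
    by (simp add: complex_vector.independent_insertI)
  then have "enat (card {(x, 1::complex), (y, 1)}) \<le> geometric_multiplicity S c"
    unfolding geometric_multiplicity_def using assms(2,3)
    by (intro SUP_upper) (auto simp: eigenspace_def)
  then show ?thesis using assms(1) by (simp add: numeral_eq_enat numeral_2_eq_2)
qed

lemma commuting_fixes_hyperbolic_fixed_point:
  assumes T: "T \<in> isometries" and S: "S \<in> isometries" and ST: "S \<circ> T = T \<circ> S"
    and ne: "\<not> elliptic T"
    and fixed: "{x \<in> cball 0 1. ball_map T x = x} = {x, y}"
    and xy: "x \<noteq> y" and sphere: "norm x = 1" "norm y = 1"
  shows "\<exists>p. S (x, 1) = p *\<^sub>C (x, 1)"
proof -
  have "ball_map T x = x" "ball_map T y = y" using fixed by blast+
  then obtain a b where a: "T (x, 1) = a *\<^sub>C (x, 1)" and b: "T (y, 1) = b *\<^sub>C (y, 1)"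
    using ball_map_fixed_iff[OF T] sphere by (metis order_refl)
  let ?w = "S (x, 1)"
  \<comment> \<open>By commutation \<open>S\<close> maps each eigenspace of \<open>T\<close> into
    itself.\<close>
  have Tw: "T ?w = a *\<^sub>C ?w"
    using fun_cong[OF ST, of "(x, 1)"] by (simp add: a isometries_scaleC[OF S])
  have null: "herm_form (x, 1::complex) (x, 1) = 0" "herm_form (y, 1::complex) (y, 1) = 0"
    using sphere by (simp_all add: herm_form_self)
  have "(x, 1::complex) \<noteq> 0" by (simp add: zero_prod_def)
  then have w: "Re (herm_form ?w ?w) \<le> 0" "?w \<noteq> 0"
    using null S by (simp_all add: isometries_herm_form isometries_eq_0_iff)
  note lift = scaleC_snd_lift[OF snd_nonzero_if_not_spacelike[OF w]]
  \<comment> \<open>As a light-like eigenvector of \<open>T\<close>, \<open>?w\<close> lies over one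
    of the two fixed points of its ball map.\<close>
  have "inverse (snd ?w) *\<^sub>C fst ?w \<in> {x, y}"
    unfolding fixed[symmetric] using eigenvector_ball_map_fixed[OF T Tw w] by simp
  then consider "inverse (snd ?w) *\<^sub>C fst ?w = x" | "inverse (snd ?w) *\<^sub>C fst ?w = y"
    by blast
  then show ?thesis
  proof cases
    case 1
    show ?thesis by (rule exI) (fact lift[unfolded 1])
  next
    case 2
    define c where "c = snd ?w"
    have c: "?w = c *\<^sub>C (y, 1)" "c \<noteq> 0"
      unfolding c_def by (fact lift[unfolded 2], fact snd_nonzero_if_not_spacelike[OF w])
    \<comment> \<open>If \<open>S\<close> moved the line over \<open>x\<close> to the line over
      \<open>y\<close>, the latter would carry both eigenvalues \<open>a\<close> and
      \<open>b\<close>. Equal eigenvalues yield a time-like eigenvector of \<open>T\<close>, against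
      \<open>ne\<close>.\<close>
    have "c *\<^sub>C b *\<^sub>C (y, 1::complex) = a *\<^sub>C c *\<^sub>C (y, 1)"
      using Tw unfolding c(1) isometries_scaleC[OF T] b .
    then have "a = b"
      using c(2) by (simp add: scaleC_prod_def scaleC_complex_def)
    with b have b': "T (y, 1) = a *\<^sub>C (y, 1)" by simp
    have "herm_form (x, 1) (y, 1) \<noteq> 0"
      using herm_form_lift_nonzero[of x y] xy sphere by simp
    note neg = lightlike_pair_timelike_combination[OF null this]
    show ?thesis
      using timelike_eigenvector_elliptic[OF T eigenvector_combination[OF T a b'] neg] ne by blast
  qed
qed

theorem corollary1p6p1:
  fixes S T :: "'h::complex_hilbert \<times> complex \<Rightarrow> 'h \<times> complex"
  assumes "T \<in> isometries" and "hyperbolic T"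
    and "S \<in> isometries" and "S \<circ> T = T \<circ> S"
  shows "boundary_elliptic S \<or> hyperbolic S"
proof -
  note T = assms(1) and S = assms(3)
  have ne: "\<not> elliptic T" and "card {x \<in> cball 0 1. ball_map T x = x} = 2"
    and sub: "{x \<in> cball 0 1. ball_map T x = x} \<subseteq> sphere 0 1"
    using assms(2) by (auto simp: hyperbolic_def)
  then obtain x y where fixed: "{x \<in> cball 0 1. ball_map T x = x} = {x, y}" and xy: "x \<noteq> y"
    by (auto simp: card_2_iff)
  have norms: "norm x = 1" "norm y = 1" using sub fixed by auto
  \<comment> \<open>The roles of \<open>x\<close> and \<open>y\<close> are exchanged so that the
    same lemma also applies to \<open>y\<close>.\<close>
  have fixed': "{x \<in> cball 0 1. ball_map T x = x} = {y, x}" using fixed by blast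
  obtain p where p: "S (x, 1) = p *\<^sub>C (x, 1)"
    using commuting_fixes_hyperbolic_fixed_point[OF T S assms(4) ne fixed xy norms] by blast
  obtain q where q: "S (y, 1) = q *\<^sub>C (y, 1)"
    using commuting_fixes_hyperbolic_fixed_point[OF T S assms(4) ne fixed' xy[symmetric]] norms
    by blast
  have nz: "herm_form (x, 1) (y, 1) \<noteq> 0"
    using herm_form_lift_nonzero[of x y] xy norms by simp
  show ?thesis
  proof (cases "p = q")
    case True
    have null: "herm_form (x, 1::complex) (x, 1) = 0" "herm_form (y, 1::complex) (y, 1) = 0"
      using norms by (simp_all add: herm_form_self)
    note neg = lightlike_pair_timelike_combination[OF null nz]
    \<comment> \<open>The coefficient matches the one in \<open>neg\<close>, so both facts concern
      the same vector.\<close>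
    note ev = eigenvector_combination[OF S p q[folded True], of "- herm_form (x, 1) (y, 1)"]
    have "elliptic S" using timelike_eigenvector_elliptic[OF S ev neg] .
    moreover have "timelike_eigenvalue S p"
      unfolding timelike_eigenvalue_def eigenspace_def using ev neg by blast
    moreover have "geometric_multiplicity S p \<ge> 2"
      using geometric_multiplicity_ge_2[of x y S p] xy p q True by blast
    ultimately show ?thesis by (auto simp: boundary_elliptic_def)
  next
    case False
    have only: "z = x \<or> z = y" if z: "norm z \<le> 1" "ball_map S z = z" for z
    proof (rule ccontr)
      assume *: "\<not> (z = x \<or> z = y)"
      obtain r where r: "S (z, 1) = r *\<^sub>C (z, 1)"
        using ball_map_fixed_iff[OF S z(1)] z(2) by blast
      \<comment> \<open>The lift of \<open>z\<close> pairs nontrivially with the lifts of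
        \<open>x\<close> and \<open>y\<close>, since \<open>z\<close> differs from both. Cancelling
        the nonzero \<open>r\<close> then forces \<open>p = q\<close>.\<close>
      have "r * cnj p = 1" "r * cnj q = 1"
        using eigenvalue_product[OF S r p] eigenvalue_product[OF S r q]
          herm_form_lift_nonzero[OF z(1)] * norms by auto
      then have "p = q" by (metis complex_cnj_cancel_iff mult_cancel_left mult_zero_left zero_neq_one)
      then show False using False by blast
    qed
    have "ball_map S x = x" "ball_map S y = y"
      using ball_map_fixed_iff[OF S] norms p q by auto
    then have "{z \<in> cball 0 1. ball_map S z = z} = {x, y}"
      using only norms by auto
    \<comment> \<open>A fixed point in the open ball would be \<open>x\<close> or \<open>y\<close>,
      but both have norm 1.\<close>
    moreover have "\<not> elliptic S"
      using only norms by (force simp: elliptic_def)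
    ultimately show ?thesis using xy norms by (simp add: hyperbolic_def)
  qed
qed

end
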